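(* Let $a, b \in \mathbb{R}$ with $b - a \in \mathbb{N}_1$, let $1 < \nu < 2$, and let $\alpha, \beta, \gamma, \delta \in \mathbb{R}$ with $\alpha^2 + \beta^2 > 0$, $\gamma^2 + \delta^2 > 0$. Assume $\alpha, \beta, \gamma, \delta \geq 0$, $\beta \geq \alpha$, and $\xi \neq 0$, where $\xi = (\beta - \alpha)\gamma + \alpha\gamma H_{\nu-1}(b,a) + \alpha\delta H_{\nu-2}(b,a)$. Then the function $G$ defined in the context (the Green's function of the nabla fractional boundary value problem $-(\nabla^\nu_a u)(t) = 0$ for $t \in \mathbb{N}_{a+2}^b$, $\alpha u(a+1) - \beta(\nabla u)(a+1) = 0$, $\gamma u(b) + \delta(\nabla u)(b) = 0$) satisfies $G(t,s) \geq 0$ for all $(t,s) \in \mathbb{N}_a^b \times \mathbb{N}_{a+1}^b$.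
   Context: Notation: $\mathbb{N}_c = \{c, c+1, c+2, \ldots\}$ and $\mathbb{N}_c^d = \{c, c+1, \ldots, d\}$ when $d - c$ is a nonnegative integer. The backward jump operator is $\rho(a) = a$ and $\rho(t) = t-1$ for $t \in \mathbb{N}_{a+1}$; throughout, for $s\in\mathbb{N}_{a+1}$, $\rho(s) = s-1$. The generalized rising function is $t^{\overline{r}} = \Gamma(t+r)/\Gamma(t)$ when $t$ and $t+r$ are not in $\{\ldots,-2,-1,0\}$, and $t^{\overline{r}} := 0$ when $t \in \{\ldots,-2,-1,0\}$ and $t+r \notin \{\ldots,-2,-1,0\}$. The nabla fractional Taylor monomial of order $\mu$ (with $\mu \notin \{\ldots,-2,-1\}$) is $H_\mu(t,c) = \frac{(t-c)^{\overline{\mu}}}{\Gamma(\mu+1)}$; in particular $H_\mu(c,c)=0$. Nabla operators: $(\nabla u)(t) = u(t) - u(t-1)$, $\nabla^2 = \nabla\nabla$; for $\mu>0$, $(\nabla_a^{-\mu}u)(t) = \sum_{s=a+1}^t H_{\mu-1}(t,\rho(s))u(s)$ for $t\in\mathbb{N}_a$ (equal to $0$ at $t=a$); for $1<\nu<2$, $(\nabla_a^\nu u)(t) = \big(\nabla^2(\nabla_a^{-(2-\nu)}u)\big)(t)$, $t \in \mathbb{N}_{a+2}$. Green's function: for $\xi \ne 0$, $G(t,s) = u(t,s)$ if $t \leq s-1$ and $G(t,s) = v(t,s)$ if $t \geq s$, where $$u(t,s) = \frac{1}{\xi}\Big[\alpha\gamma H_{\nu-1}(t,a)H_{\nu-1}(b,\rho(s))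 + \alpha\delta H_{\nu-1}(t,a)H_{\nu-2}(b,\rho(s)) + (\beta-\alpha)\gamma H_{\nu-1}(b,\rho(s)) + (\beta-\alpha)\delta H_{\nu-2}(b,\rho(s))\Big],$$ $$v(t,s) = u(t,s) - H_{\nu-1}(t,\rho(s)).$$ *)

theory Defs
  imports "HOL-Analysis.Gamma_Function"
begin

definition nats_from :: "real \<Rightarrow> real set" where
  "nats_from c = {c + real k |k. True}"

definition nats_between :: "real \<Rightarrow> real \<Rightarrow> real set" where
  "nats_between c d = {t \<in> nats_from c. t \<le> d}"

text \<open>The base point \<open>a\<close> of the time scale, where the backward jump is the identity,
  is an explicit argument.\<close>

definition back_jump :: "real \<Rightarrow> real \<Rightarrow> real" where
  "back_jump a t = (if t = a then a else t - 1)"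

text \<open>The convention \<open>0\<close> applies when \<open>t\<close> is a pole of \<open>Gamma\<close> and \<open>t + r\<close> is not. When \<open>t + r\<close>
  is a pole the generalized rising function is undefined, and \<open>0\<close> is a dummy value.\<close>

definition rising :: "real \<Rightarrow> real \<Rightarrow> real" where
  "rising t r =
     (if t \<notin> \<int>\<^sub>\<le>\<^sub>0 \<and> t + r \<notin> \<int>\<^sub>\<le>\<^sub>0 then Gamma (t + r) / Gamma t else 0)"

text \<open>Nabla fractional Taylor monomial \<open>H\<^sub>\<mu>(t, c)\<close>, meaningful for \<open>\<mu>\<close> not a negative integer.\<close>

definition taylor_monomial :: "real \<Rightarrow> real \<Rightarrow> real \<Rightarrow> real" where
  "taylor_monomial \<mu> t c = rising (t - c) \<mu> / Gamma (\<mu> + 1)"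

definition green_xi ::
  "real \<Rightarrow> real \<Rightarrow> real \<Rightarrow> real \<Rightarrow> real \<Rightarrow> real \<Rightarrow> real \<Rightarrow> real" where
  "green_xi a b \<nu> \<alpha> \<beta> \<gamma> \<delta> =
     (\<beta> - \<alpha>) * \<gamma> + \<alpha> * \<gamma> * taylor_monomial (\<nu> - 1) b a + \<alpha> * \<delta> * taylor_monomial (\<nu> - 2) b a"

definition green_u ::
  "real \<Rightarrow> real \<Rightarrow> real \<Rightarrow> real \<Rightarrow> real \<Rightarrow> real \<Rightarrow> real \<Rightarrow> real \<Rightarrow> real \<Rightarrow> real" where
  "green_u a b \<nu> \<alpha> \<beta> \<gamma> \<delta> t s =
     1 / green_xi a b \<nu> \<alpha> \<beta> \<gamma> \<delta> *
       (\<alpha> * \<gamma> * taylor_monomial (\<nu> - 1) t a * taylor_monomial (\<nu> - 1) b (back_jump a s)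
      + \<alpha> * \<delta> * taylor_monomial (\<nu> - 1) t a * taylor_monomial (\<nu> - 2) b (back_jump a s)
      + (\<beta> - \<alpha>) * \<gamma> * taylor_monomial (\<nu> - 1) b (back_jump a s)
      + (\<beta> - \<alpha>) * \<delta> * taylor_monomial (\<nu> - 2) b (back_jump a s))"

definition green_v ::
  "real \<Rightarrow> real \<Rightarrow> real \<Rightarrow> real \<Rightarrow> real \<Rightarrow> real \<Rightarrow> real \<Rightarrow> real \<Rightarrow> real \<Rightarrow> real" where
  "green_v a b \<nu> \<alpha> \<beta> \<gamma> \<delta> t s =
     green_u a b \<nu> \<alpha> \<beta> \<gamma> \<delta> t s - taylor_monomial (\<nu> - 1) t (back_jump a s)"

text \<open>Green's function of \<open>- (\<nabla>\<^sub>a\<^sup>\<nu> u)(t) = 0\<close> for \<open>t\<close> in \<open>nats_between (a + 2) b\<close> with boundary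
  conditions \<open>\<alpha> u(a + 1) - \<beta> (\<nabla>u)(a + 1) = 0\<close> and \<open>\<gamma> u(b) + \<delta> (\<nabla>u)(b) = 0\<close>. For \<open>t\<close> and \<open>s\<close>
  in \<open>nats_from a\<close>, the second branch is exactly the case \<open>t \<ge> s\<close>.\<close>

definition green ::
  "real \<Rightarrow> real \<Rightarrow> real \<Rightarrow> real \<Rightarrow> real \<Rightarrow> real \<Rightarrow> real \<Rightarrow> real \<Rightarrow> real \<Rightarrow> real" where
  "green a b \<nu> \<alpha> \<beta> \<gamma> \<delta> t s =
     (if t \<le> s - 1 then green_u a b \<nu> \<alpha> \<beta> \<gamma> \<delta> t s else green_v a b \<nu> \<alpha> \<beta> \<gamma> \<delta> t s)"

end

theory Submission imports Defs begin

text \<open>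
  The Green's function is a sum over the four products \<open>\<alpha>\<gamma>\<close>, \<open>\<alpha>\<delta>\<close>, \<open>(\<beta> - \<alpha>)\<gamma>\<close>,
  \<open>(\<beta> - \<alpha>)\<delta>\<close> of nonnegative parameters, divided by \<open>\<xi>\<close>. All Taylor monomials that
  occur are nonnegative, so \<open>\<xi> > 0\<close> and the branch \<open>u\<close> above the diagonal is nonnegative at once.

  For the branch \<open>v\<close>, multiply by \<open>\<xi>\<close> and compare coefficients of each parameter product. Put
  \<open>h = H\<^bsub>\<nu>-1\<^esub>\<close> and \<open>k = H\<^bsub>\<nu>-2\<^esub>\<close> as functions of the integer distance to the base
  point, and write \<open>j = \<rho>(s) - a\<close>, \<open>p = t - \<rho>(s) \<ge> 1\<close>, \<open>q = b - \<rho>(s) \<ge> p\<close>. It remains to see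
  \<open>h(p) \<le> h(q)\<close> for \<open>(\<beta> - \<alpha>)\<gamma>\<close>, \<open>h(p) k(q + j) \<le> h(p + j) k(q)\<close> for \<open>\<alpha>\<delta>\<close>, and
  \<open>h(p) h(q + j) \<le> h(p + j) h(q)\<close> for \<open>\<alpha>\<gamma>\<close>; the term with \<open>(\<beta> - \<alpha>)\<delta>\<close> has nothing to offset.
  Everything follows from the ratio of consecutive values
  \<open>H\<^sub>\<mu>(n + 1) / H\<^sub>\<mu>(n) = 1 + \<mu> / n\<close>: it is at least 1 for \<open>\<mu> = \<nu> - 1 > 0\<close>, so \<open>h\<close> increases;
  it is at most 1 for \<open>\<mu> = \<nu> - 2 < 0\<close>, so \<open>k\<close> decreases; and it decreases in \<open>n\<close> for
  \<open>\<mu> > 0\<close>, so \<open>h\<close> is log-concave, which is the third inequality.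
\<close>

lemma taylor_monomial_shift: "taylor_monomial \<mu> t c = taylor_monomial \<mu> (t - c) 0"
  by (simp add: taylor_monomial_def)

lemma taylor_monomial_eq_Gamma:
  assumes "x > 0" "x + \<mu> > 0"
  shows "taylor_monomial \<mu> x 0 = Gamma (x + \<mu>) / (Gamma x * Gamma (\<mu> + 1))"
  using assms by (auto simp: taylor_monomial_def rising_def elim!: nonpos_Ints_cases)

lemma taylor_monomial_zero: "taylor_monomial \<mu> 0 0 = 0"
  by (simp add: taylor_monomial_def rising_def)

lemma taylor_monomial_pos:
  assumes "\<mu> > -1" "n \<ge> 1"
  shows "taylor_monomial \<mu> (real n) 0 > 0"
  using assms by (simp add: taylor_monomial_eq_Gamma Gamma_real_pos)

lemma taylor_monomial_nonneg:
  assumes "\<mu> > -1"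
  shows "taylor_monomial \<mu> (real n) 0 \<ge> 0"
  using taylor_monomial_pos[OF assms, of n] by (cases "n = 0") (auto simp: taylor_monomial_zero)

text \<open>
  Applying \<open>\<Gamma>(z + 1) = z \<Gamma>(z)\<close> in numerator and denominator of the Gamma quotient. This
  recurrence is the only analytic input to the comparisons below.
\<close>

lemma taylor_monomial_Suc:
  assumes "\<mu> > -1" "n \<ge> 1"
  shows "taylor_monomial \<mu> (real (Suc n)) 0 = (1 + \<mu> / real n) * taylor_monomial \<mu> (real n) 0"
proof -
  have pos: "real n > 0" "real n + \<mu> > 0"
    using assms by auto
  have "Gamma (real n + 1) = real n * Gamma (real n)"
    using pos by (intro Gamma_plus1) (auto elim!: nonpos_Ints_cases)
  moreover have "Gamma (real n + \<mu> + 1) = (real n + \<mu>) * Gamma (real n + \<mu>)"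
    using pos by (intro Gamma_plus1) (auto elim!: nonpos_Ints_cases)
  ultimately show ?thesis
    using pos by (simp add: taylor_monomial_eq_Gamma field_simps)
qed

lemma taylor_monomial_mono:
  assumes "\<mu> \<ge> 0" "m \<le> n"
  shows "taylor_monomial \<mu> (real m) 0 \<le> taylor_monomial \<mu> (real n) 0"
  using assms(2)
proof (induction n rule: dec_induct)
  case base
  then show ?case by simp
next
  case (step n)
  have "taylor_monomial \<mu> (real n) 0 \<le> taylor_monomial \<mu> (real (Suc n)) 0"
  proof (cases "n = 0")
    case True
    then show ?thesis
      using taylor_monomial_nonneg[of \<mu> "Suc n"] assms(1) by (simp add: taylor_monomial_zero)
  next
    case False
    have "1 * taylor_monomial \<mu> (real n) 0 \<le> (1 + \<mu> / real n) * taylor_monomial \<mu> (real n) 0"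
      using assms(1) by (intro mult_right_mono taylor_monomial_nonneg) auto
    then show ?thesis
      using taylor_monomial_Suc[of \<mu> n] False assms(1) by simp
  qed
  with step.IH show ?case by linarith
qed

text \<open>
  The range starts at 1 because of the jump from the conventional value \<open>H\<^sub>\<mu>(0) = 0\<close> up to
  \<open>H\<^sub>\<mu>(1) = 1\<close>.
\<close>

lemma taylor_monomial_antimono:
  assumes "-1 < \<mu>" "\<mu> \<le> 0" "1 \<le> m" "m \<le> n"
  shows "taylor_monomial \<mu> (real n) 0 \<le> taylor_monomial \<mu> (real m) 0"
  using assms(4)
proof (induction n rule: dec_induct)
  case base
  then show ?case by simp
next
  case (step n)
  have "(1 + \<mu> / real n) * taylor_monomial \<mu> (real n) 0 \<le> 1 * taylor_monomial \<mu> (real n) 0"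
    using assms by (intro mult_right_mono taylor_monomial_nonneg) (auto simp: divide_nonpos_nonneg)
  moreover have "taylor_monomial \<mu> (real (Suc n)) 0 = (1 + \<mu> / real n) * taylor_monomial \<mu> (real n) 0"
    using assms step.hyps by (intro taylor_monomial_Suc) auto
  ultimately show ?case
    using step.IH by linarith
qed

text \<open>
  Log-concavity: the growth ratio \<open>1 + \<mu> / n\<close> decreases in \<open>n\<close>, so raising \<open>q\<close> by one multiplies
  the right-hand side by at least as much as the left-hand side, and at \<open>q = p\<close> both sides agree.
\<close>

lemma taylor_monomial_log_concave:
  assumes "\<mu> \<ge> 0" "1 \<le> p" "p \<le> q"
  shows "taylor_monomial \<mu> (real p) 0 * taylor_monomial \<mu> (real (q + j)) 0
       \<le> taylor_monomial \<mu> (real (p + j)) 0 * taylor_monomial \<mu> (real q) 0"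
  using assms(3)
proof (induction q rule: dec_induct)
  case base
  then show ?case by (simp add: mult.commute)
next
  case (step q)
  let ?h = "\<lambda>n. taylor_monomial \<mu> (real n) 0"
  have "?h p * ?h (Suc q + j) = (1 + \<mu> / real (q + j)) * (?h p * ?h (q + j))"
    using taylor_monomial_Suc[of \<mu> "q + j"] assms step.hyps by simp
  also have "\<dots> \<le> (1 + \<mu> / real q) * (?h (p + j) * ?h q)"
  proof (rule mult_mono)
    show "1 + \<mu> / real (q + j) \<le> 1 + \<mu> / real q"
      using assms step.hyps by (auto intro!: divide_left_mono)
    show "0 \<le> ?h p * ?h (q + j)"
      using assms(1) by (intro mult_nonneg_nonneg taylor_monomial_nonneg) auto
  qed (use step.IH assms(1) in auto)
  also have "\<dots> = ?h (p + j) * ?h (Suc q)"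
    using taylor_monomial_Suc[of \<mu> q] assms step.hyps by simp
  finally show ?case .
qed

theorem theorem3p1:
  fixes a b \<nu> \<alpha> \<beta> \<gamma> \<delta> :: real
  assumes "b - a \<in> nats_from 1"
    and "1 < \<nu>" and "\<nu> < 2"
    and "\<alpha>\<^sup>2 + \<beta>\<^sup>2 > 0" and "\<gamma>\<^sup>2 + \<delta>\<^sup>2 > 0"
    and "\<alpha> \<ge> 0" and "\<beta> \<ge> 0" and "\<gamma> \<ge> 0" and "\<delta> \<ge> 0"
    and "\<beta> \<ge> \<alpha>"
    and "green_xi a b \<nu> \<alpha> \<beta> \<gamma> \<delta> \<noteq> 0"
  shows "\<forall>t \<in> nats_between a b. \<forall>s \<in> nats_between (a + 1) b.
           green a b \<nu> \<alpha> \<beta> \<gamma> \<delta> t s \<ge> 0"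
proof (intro ballI)
  fix t s
  assume t: "t \<in> nats_between a b" and s: "s \<in> nats_between (a + 1) b"
  obtain N where "b - a = 1 + real N"
    using assms(1) by (auto simp: nats_from_def)
  then have b: "b = a + real (Suc N)"
    by simp
  obtain T where T: "t = a + real T"
    using t by (auto simp: nats_between_def nats_from_def)
  obtain j where j: "s = a + 1 + real j"
    using s by (auto simp: nats_between_def nats_from_def)
  have TN: "T \<le> Suc N"
    using t T b by (simp add: nats_between_def)
  have jN: "j \<le> N"
    using s j b by (simp add: nats_between_def)
  define q where "q = Suc N - j"
  have N: "Suc N = q + j" and q: "1 \<le> q"
    using jN by (auto simp: q_def)
  define h k where "h n = taylor_monomial (\<nu> - 1) (real n) 0"
    and "k n = taylor_monomial (\<nu> - 2) (real n) 0" for n :: nat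
  define \<xi> where "\<xi> = green_xi a b \<nu> \<alpha> \<beta> \<gamma> \<delta>"
  have h0: "h n \<ge> 0" and k0: "k n \<ge> 0" for n
    using assms(2) by (auto simp: h_def k_def intro!: taylor_monomial_nonneg)
  have H: "taylor_monomial (\<nu> - 1) (c + real n) c = h n"
      "taylor_monomial (\<nu> - 2) (c + real n) c = k n" for n c
    by (subst taylor_monomial_shift, simp add: h_def k_def)+
  have \<xi>: "\<xi> = (\<beta> - \<alpha>) * \<gamma> + \<alpha> * \<gamma> * h (q + j) + \<alpha> * \<delta> * k (q + j)"
    unfolding \<xi>_def green_xi_def b N H ..
  have "\<xi> \<ge> 0"
    unfolding \<xi> using assms h0 k0 by (intro add_nonneg_nonneg mult_nonneg_nonneg) auto
  then have \<xi>_pos: "\<xi> > 0"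
    using assms(11) by (simp add: \<xi>_def)
  have jump: "back_jump a s = a + real j"
    by (simp add: back_jump_def j)
  have b_jump: "b = (a + real j) + real q"
    using b N by simp
  define u where "u = \<alpha> * \<gamma> * h T * h q + \<alpha> * \<delta> * h T * k q + (\<beta> - \<alpha>) * \<gamma> * h q
    + (\<beta> - \<alpha>) * \<delta> * k q"
  have green_u: "green_u a b \<nu> \<alpha> \<beta> \<gamma> \<delta> t s = u / \<xi>"
  proof -
    have "taylor_monomial (\<nu> - 1) b (back_jump a s) = h q"
        "taylor_monomial (\<nu> - 2) b (back_jump a s) = k q"
      unfolding jump b_jump by (rule H)+
    then show ?thesis
      by (simp add: green_u_def u_def T H flip: \<xi>_def)
  qed
  show "green a b \<nu> \<alpha> \<beta> \<gamma> \<delta> t s \<ge> 0"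
  proof (cases "t \<le> s - 1")
    case True
    have "u \<ge> 0"
      unfolding u_def using assms h0 k0 by (intro add_nonneg_nonneg mult_nonneg_nonneg) auto
    then show ?thesis
      using True \<xi>_pos by (simp add: green_def green_u)
  next
    case False
    then have "j < T"
      using T j by simp
    then obtain p where Tp: "T = p + j" and p: "1 \<le> p"
      by (intro that[of "T - j"]) auto
    have pq: "p \<le> q"
      using TN N Tp by simp
    have t_jump: "t = (a + real j) + real p"
      using T Tp by simp
    have "taylor_monomial (\<nu> - 1) t (back_jump a s) = h p"
      unfolding jump t_jump by (rule H)
    then have v: "green a b \<nu> \<alpha> \<beta> \<gamma> \<delta> t s = u / \<xi> - h p"
      using False by (simp add: green_def green_v_def green_u)
    have "h p \<le> h q"
      using assms(2) pq unfolding h_def by (intro taylor_monomial_mono) auto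
    moreover have "h p * k (q + j) \<le> h (p + j) * k q"
    proof (rule mult_mono)
      show "h p \<le> h (p + j)"
        using assms(2) unfolding h_def by (intro taylor_monomial_mono) auto
      show "k (q + j) \<le> k q"
        using assms(2,3) q unfolding k_def by (intro taylor_monomial_antimono) auto
    qed (use h0 k0 in auto)
    moreover have "h p * h (q + j) \<le> h (p + j) * h q"
      using assms(2) p pq unfolding h_def by (intro taylor_monomial_log_concave) auto
    ultimately have "((\<beta> - \<alpha>) * \<gamma>) * h p + (\<alpha> * \<gamma>) * (h p * h (q + j)) + (\<alpha> * \<delta>) * (h p * k (q + j)) + 0
      \<le> ((\<beta> - \<alpha>) * \<gamma>) * h q + (\<alpha> * \<gamma>) * (h (p + j) * h q) + (\<alpha> * \<delta>) * (h (p + j) * k q)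
        + (\<beta> - \<alpha>) * \<delta> * k q"
      using assms k0 by (intro add_mono mult_left_mono mult_nonneg_nonneg) auto
    then have "h p * \<xi> \<le> u"
      by (simp add: \<xi> u_def Tp algebra_simps)
    then show ?thesis
      using \<xi>_pos by (simp add: v field_simps)
  qed
qed

end
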